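(* Fix $a,b\in\mathbb C$ with $\operatorname{Re}a>0$ and $\operatorname{Re}b>0$. For $N=0,1,2,\dots$ consider the diagonal $\mathbb C^2$-action on $\mathbb C^3$ with weights $\Lambda_0=(1,0)$, $\Lambda_1^{(N)}=(a+N,1)$ and $\Lambda_2=(b,-1)$. Every member has uniform maximal rank and lies in the Poincaré domain. Along the singular support $I=\{0\}$, all members have the same residual weights $+1,-1$, hence the same affine-line envelope $Q_I\simeq\mathbb C$ with coordinate $X=w_1w_2$. Their envelope monodromy is independent of $N$ and acts (for the positive generator of the period group) by $$X\longmapsto e^{2\pi\sqrt{-1}\,(a+b)}X.$$ However, the Camacho--Sad index of the invariant curve $C_{I,0}$ is $$\operatorname{Ind}_{\mathrm{CS}}(\mathscr H_{I,0}^{(N)},C_{I,0};(0,o_I))=a+b+N.$$ Thus the transverse envelope, the envelope monodromy, its action groupoid $\Gamma_I\ltimes_{\rho_I}Q_I$ and its quotient stack $[Q_I/\Gamma_I]$ are the same for all $N$, whereas the logarithmic connections and these Camacho--Sad indices are pairwise distinct.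
   Context: Coordinates of $\mathbb C^3$ are $z_0,z_1,z_2$, indexed by $\{0,1,2\}$, and the action is $t\cdot z=(e^{\Lambda_j(t)}z_j)_j$, $t\in\mathfrak g=\mathbb C^2$. Uniform maximal rank: every subcollection of at most $2$ weights is linearly independent. Poincaré domain: some $\xi\in\mathbb C^2$ has $\operatorname{Re}\Lambda_j(\xi)>0$ for all $j$. For $I=\{0\}$, $J=\{1,2\}$: $\mathfrak h_I=\ker\Lambda_0$; residual weights $\Lambda_j|_{\mathfrak h_I}$, $j\in J$; $S_I=\{\alpha\in\mathbb N^J:\sum_{j\in J}\alpha_j\Lambda_j|_{\mathfrak h_I}=0\}$; $Q_I=\operatorname{Spec}\mathbb C[S_I]$ with basis $X^\alpha=w^\alpha$ and distinguished point $o_I$ (the image of $w=0$); $V_I=\mathfrak g/\mathfrak h_I$; $\Gamma_I=\{t:\Lambda_0(t)\in2\pi\sqrt{-1}\,\mathbb Z\}/\mathfrak h_I$, identified with $2\pi\sqrt{-1}\,\mathbb Z$ via $\Lambda_0$. The envelope monodromy $\rho_I(\gamma)$ acts by $X^\alpha\mapsto e^{\nu_\alpha(\gamma)}X^\alpha$, $\nu_\alpha=\sum_{j\in J}\alpha_j\Lambda_j\in V_I^*$. Writing $\nu_\alpha=c_0(\alpha)\Lambda_0$, put $\delta_0X^\alpha=c_0(\alpha)X^\alpha$; the logarithmic connection on $\mathcal O_{\mathbb C^*}\otimes\mathbb C[S_I]$ is $\nabla_I=d-\frac{dz_0}{z_0}\delta_0$. With $\Delta_0$ the disk germ at $z_0=0$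 with coordinate $t=z_0$, $\mathscr H_{I,0}^{(N)}$ is the foliation on $\Delta_0\times Q_I$ generated by the vector field $t\frac{\partial}{\partial t}+\delta_0$, and $C_{I,0}=\Delta_0\times\{o_I\}=\{X=0\}$. For a foliation on a surface generated by $A\,\partial_t+B\,\partial_x$ with invariant smooth curve $\{x=0\}$, the Camacho--Sad index at $(0,0)$ is $\operatorname{Res}_{t=0}\frac{\partial}{\partial x}(B/A)(t,0)\,dt$. *)

theory Defs
  imports
    "HOL-Complex_Analysis.Complex_Residues"
    "HOL-Library.Poly_Mapping"
    "HOL-Library.FuncSet"
    "HOL-Algebra.Coset"
    "HOL-Algebra.Generated_Groups"
begin

section \<open>Weights and the diagonal action\<close>

text \<open>
  The index set \<open>{0,1,2}\<close> is the numeral type \<open>3\<close>, whose elements are exactly \<open>0\<close>, \<open>1\<close>, \<open>2\<close>.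
  The Lie algebra \<open>\<gg>\<close> is \<^typ>\<open>complex^2\<close>, with components \<open>t $ 1\<close> and \<open>t $ 2\<close>, and a weight is
  given by its coefficient vector.
\<close>

type_synonym weights = "3 \<Rightarrow> complex^2"

definition pairing :: "complex^2 \<Rightarrow> complex^2 \<Rightarrow> complex" where
  "pairing l t = (\<Sum>i\<in>UNIV. l $ i * t $ i)"

definition diag_action :: "weights \<Rightarrow> complex^2 \<Rightarrow> complex^3 \<Rightarrow> complex^3" where
  "diag_action \<Lambda> t z = (\<chi> j. exp (pairing (\<Lambda> j) t) * z $ j)"

text \<open>Independence is that of the family: a repeated weight counts as a dependence.\<close>

definition uniform_maximal_rank :: "weights \<Rightarrow> bool" where
  "uniform_maximal_rank \<Lambda> \<longleftrightarrow>
     (\<forall>K. card K \<le> 2 \<longrightarrow> inj_on \<Lambda> K \<and> vec.independent (\<Lambda> ` K))"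

definition poincare_domain :: "weights \<Rightarrow> bool" where
  "poincare_domain \<Lambda> \<longleftrightarrow> (\<exists>\<xi>. \<forall>j. Re (pairing (\<Lambda> j) \<xi>) > 0)"

definition weights_family :: "complex \<Rightarrow> complex \<Rightarrow> nat \<Rightarrow> weights" where
  "weights_family a b N j =
     (if j = 0 then vector [1, 0] else if j = 1 then vector [a + of_nat N, 1] else vector [b, -1])"


section \<open>The transverse envelope along \<open>I = {0}\<close>, \<open>J = {1,2}\<close>\<close>

definition isotropy :: "weights \<Rightarrow> (complex^2) set" where
  "isotropy \<Lambda> = {t. pairing (\<Lambda> 0) t = 0}"

definition residual_weight :: "weights \<Rightarrow> 3 \<Rightarrow> complex^2 \<Rightarrow> complex" where
  "residual_weight \<Lambda> j = restrict (pairing (\<Lambda> j)) (isotropy \<Lambda>)"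

text \<open>Elements of \<open>\<nat>\<^sup>J\<close> are exponents \<^typ>\<open>3 \<Rightarrow>\<^sub>0 nat\<close> supported in \<open>{1,2}\<close>.\<close>

definition resonance_monoid :: "weights \<Rightarrow> (3 \<Rightarrow>\<^sub>0 nat) set" where
  "resonance_monoid \<Lambda> =
     {\<alpha>. Poly_Mapping.keys \<alpha> \<subseteq> {1, 2} \<and>
         (\<forall>t\<in>isotropy \<Lambda>.
            (\<Sum>j\<in>{1, 2}. of_nat (Poly_Mapping.lookup \<alpha> j) * residual_weight \<Lambda> j t) = 0)}"

text \<open>
  \<open>mpoly3\<close>, with the convolution product of \<^typ>\<open>'a \<Rightarrow>\<^sub>0 'b\<close>, is the polynomial ring in
  \<open>w\<^sub>0, w\<^sub>1, w\<^sub>2\<close>; the monoid algebra \<open>\<complex>[S\<^sub>I]\<close> is its subalgebra spanned by the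
  monomials \<open>w\<^sup>\<alpha>\<close> with \<open>\<alpha> \<in> S\<^sub>I\<close>.
\<close>

type_synonym mpoly3 = "(3 \<Rightarrow>\<^sub>0 nat) \<Rightarrow>\<^sub>0 complex"

definition const :: "complex \<Rightarrow> mpoly3" where
  "const c = Poly_Mapping.single 0 c"

definition wvar :: "3 \<Rightarrow> mpoly3" where
  "wvar j = Poly_Mapping.single (Poly_Mapping.single j 1) 1"

definition eval_mpoly :: "complex^3 \<Rightarrow> mpoly3 \<Rightarrow> complex" where
  "eval_mpoly w p =
     (\<Sum>\<alpha>\<in>Poly_Mapping.keys p. Poly_Mapping.lookup p \<alpha> * (\<Prod>j\<in>UNIV. (w $ j) ^ Poly_Mapping.lookup \<alpha> j))"

definition env_ring :: "weights \<Rightarrow> mpoly3 set" where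
  "env_ring \<Lambda> = {p. Poly_Mapping.keys p \<subseteq> resonance_monoid \<Lambda>}"

text \<open>
  The affine variety \<open>Q\<^sub>I = Spec \<complex>[S\<^sub>I]\<close> is given by its coordinate algebra together with its
  complex points, which are the \<open>\<complex>\<close>-algebra homomorphisms \<open>\<complex>[S\<^sub>I] \<rightarrow> \<complex>\<close>; the value of
  the regular function \<open>p\<close> at the point \<open>q\<close> is \<open>q p\<close>.
\<close>

definition env_points :: "weights \<Rightarrow> (mpoly3 \<Rightarrow> complex) set" where
  "env_points \<Lambda> =
     {q \<in> extensional (env_ring \<Lambda>).
        (\<forall>c. q (const c) = c) \<and>
        (\<forall>f\<in>env_ring \<Lambda>. \<forall>g\<in>env_ring \<Lambda>. q (f + g) = q f + q g \<and> q (f * g) = q f * q g)}"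

definition env_functions :: "weights \<Rightarrow> ((mpoly3 \<Rightarrow> complex) \<Rightarrow> complex) set" where
  "env_functions \<Lambda> = (\<lambda>f. \<lambda>q\<in>env_points \<Lambda>. q f) ` env_ring \<Lambda>"

text \<open>The quotient map \<open>\<complex>\<^sup>J \<rightarrow> Q\<^sub>I\<close>; the coordinate \<open>w $ 0\<close> plays no role.\<close>

definition env_proj :: "weights \<Rightarrow> complex^3 \<Rightarrow> (mpoly3 \<Rightarrow> complex)" where
  "env_proj \<Lambda> w = restrict (eval_mpoly w) (env_ring \<Lambda>)"

definition env_origin :: "weights \<Rightarrow> (mpoly3 \<Rightarrow> complex)" where
  "env_origin \<Lambda> = env_proj \<Lambda> 0"

definition envelope ::
  "weights \<Rightarrow> mpoly3 set \<times> (mpoly3 \<Rightarrow> complex) set \<times> (mpoly3 \<Rightarrow> complex)" where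
  "envelope \<Lambda> = (env_ring \<Lambda>, env_points \<Lambda>, env_origin \<Lambda>)"

definition env_X :: mpoly3 where
  "env_X = wvar 1 * wvar 2"

definition env_coord :: "(mpoly3 \<Rightarrow> complex) \<Rightarrow> complex" where
  "env_coord q = q env_X"


section \<open>Period group and envelope monodromy\<close>

definition period_lattice :: "weights \<Rightarrow> (complex^2) monoid" where
  "period_lattice \<Lambda> =
     \<lparr>carrier = {t. \<exists>k::int. pairing (\<Lambda> 0) t = 2 * pi * \<i> * of_int k}, mult = (+), one = 0\<rparr>"

definition period_group :: "weights \<Rightarrow> (complex^2) set monoid" where
  "period_group \<Lambda> = period_lattice \<Lambda> Mod isotropy \<Lambda>"

text \<open>The class corresponding to \<open>2\<pi>\<i>\<close> under the identification of \<open>\<Gamma>\<^sub>I\<close> with \<open>2\<pi>\<i>\<int>\<close> through \<open>\<Lambda>\<^sub>0\<close>.\<close>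

definition positive_generator :: "weights \<Rightarrow> (complex^2) set" where
  "positive_generator \<Lambda> = {t. pairing (\<Lambda> 0) t = 2 * pi * \<i>}"

definition nu :: "weights \<Rightarrow> (3 \<Rightarrow>\<^sub>0 nat) \<Rightarrow> complex^2" where
  "nu \<Lambda> \<alpha> = (\<Sum>j\<in>{1, 2}. of_nat (Poly_Mapping.lookup \<alpha> j) *s \<Lambda> j)"

text \<open>
  For \<open>\<alpha> \<in> S\<^sub>I\<close> the functional \<open>\<nu>\<^sub>\<alpha>\<close> vanishes on \<open>\<hh>\<^sub>I\<close>, so it takes a single value on each
  coset \<open>\<gamma>\<close>.
\<close>

definition nu_coset :: "weights \<Rightarrow> (3 \<Rightarrow>\<^sub>0 nat) \<Rightarrow> (complex^2) set \<Rightarrow> complex" where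
  "nu_coset \<Lambda> \<alpha> \<gamma> = the_elem (pairing (nu \<Lambda> \<alpha>) ` \<gamma>)"

definition env_monodromy :: "weights \<Rightarrow> (complex^2) set \<Rightarrow> mpoly3 \<Rightarrow> mpoly3" where
  "env_monodromy \<Lambda> =
     (\<lambda>\<gamma>\<in>carrier (period_group \<Lambda>). \<lambda>p\<in>env_ring \<Lambda>.
        Poly_Mapping.mapp (\<lambda>\<alpha> c. exp (nu_coset \<Lambda> \<alpha> \<gamma>) * c) p)"

text \<open>
  The induced action on points: \<open>X\<^sup>\<alpha>\<close> takes at \<open>\<gamma> \<cdot> q\<close> the value of \<open>e\<^bsup>\<nu>(\<gamma>)\<^esup> X\<^sup>\<alpha>\<close> at \<open>q\<close>. As
  \<open>\<Gamma>\<^sub>I\<close> is abelian, this is a left action.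
\<close>

definition env_act ::
  "weights \<Rightarrow> (complex^2) set \<Rightarrow> (mpoly3 \<Rightarrow> complex) \<Rightarrow> (mpoly3 \<Rightarrow> complex)" where
  "env_act \<Lambda> =
     (\<lambda>\<gamma>\<in>carrier (period_group \<Lambda>). \<lambda>q\<in>env_points \<Lambda>. \<lambda>p\<in>env_ring \<Lambda>. q (env_monodromy \<Lambda> \<gamma> p))"


text \<open>\<open>period_lattice\<close> is the stabilizer of a point of the support stratum \<open>z\<^sub>1 = z\<^sub>2 = 0\<close>.\<close>

lemma period_lattice_eq_stabilizer:
  "carrier (period_lattice \<Lambda>) = {t. diag_action \<Lambda> t (axis 0 1) = axis 0 1}"
proof -
  have "diag_action \<Lambda> t (axis 0 1) = axis 0 1 \<longleftrightarrow> exp (pairing (\<Lambda> 0) t) = 1" for t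
    by (auto simp: diag_action_def vec_eq_iff axis_def)
  moreover have "exp (pairing (\<Lambda> 0) t) = 1 \<longleftrightarrow> (\<exists>k::int. pairing (\<Lambda> 0) t = 2 * pi * \<i> * of_int k)" for t
    by (subst exp_eq_1) (auto simp: complex_eq_iff mult_ac)
  ultimately show ?thesis
    by (simp add: period_lattice_def)
qed

lemma eval_mpoly_superset:
  assumes "finite K" "Poly_Mapping.keys p \<subseteq> K"
  shows "eval_mpoly w p = (\<Sum>\<alpha>\<in>K. Poly_Mapping.lookup p \<alpha> * (\<Prod>j\<in>UNIV. (w $ j) ^ Poly_Mapping.lookup \<alpha> j))"
  unfolding eval_mpoly_def using assms
  by (intro sum.mono_neutral_left) (auto simp: in_keys_iff)

lemma eval_mpoly_add: "eval_mpoly w (p + q) = eval_mpoly w p + eval_mpoly w q"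
proof -
  let ?K = "Poly_Mapping.keys p \<union> Poly_Mapping.keys q"
  have "Poly_Mapping.keys (p + q) \<subseteq> ?K" by (rule keys_add)
  then show ?thesis
    by (simp add: eval_mpoly_superset[of ?K] lookup_add sum.distrib distrib_right)
qed

lemma eval_mpoly_single:
  "eval_mpoly w (Poly_Mapping.single \<alpha> c) = c * (\<Prod>j\<in>UNIV. (w $ j) ^ Poly_Mapping.lookup \<alpha> j)"
  by (simp add: eval_mpoly_superset[of "{\<alpha>}"])

lemma poly_mapping_single_induct:
  assumes "\<And>k v. P (Poly_Mapping.single k v)" and "\<And>f g. P f \<Longrightarrow> P g \<Longrightarrow> P (f + g)"
  shows "P (p :: 'a \<Rightarrow>\<^sub>0 'b::comm_monoid_add)"
proof (induction p rule: update_induct)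
  case const
  show ?case using assms(1)[of undefined 0] by simp
next
  case (update f a b)
  have "Poly_Mapping.update a b f = f + Poly_Mapping.single a b"
    using update by (intro poly_mapping_eqI) (auto simp: lookup_update lookup_add lookup_single in_keys_iff)
  then show ?case using assms update by simp
qed

lemma eval_mpoly_mult: "eval_mpoly w (p * q) = eval_mpoly w p * eval_mpoly w q"
proof -
  have mult_left: "eval_mpoly w (Poly_Mapping.single \<alpha> c * q) = eval_mpoly w (Poly_Mapping.single \<alpha> c) * eval_mpoly w q"
    for \<alpha> c q
  proof (induction q rule: poly_mapping_single_induct)
    case (1 k v)
    then show ?case
      by (simp add: mult_single eval_mpoly_single lookup_add power_add prod.distrib)
  next
    case (2 f g)
    then show ?case by (simp add: distrib_left eval_mpoly_add)
  qed
  show ?thesis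
  proof (induction p rule: poly_mapping_single_induct)
    case (1 k v)
    then show ?case by (rule mult_left)
  next
    case (2 f g)
    then show ?case by (simp add: distrib_right eval_mpoly_add)
  qed
qed

lemma zero_in_resonance: "0 \<in> resonance_monoid \<Lambda>"
  by (simp add: resonance_monoid_def)

lemma add_in_resonance:
  assumes "\<alpha> \<in> resonance_monoid \<Lambda>" "\<beta> \<in> resonance_monoid \<Lambda>"
  shows "\<alpha> + \<beta> \<in> resonance_monoid \<Lambda>"
proof -
  have "Poly_Mapping.keys (\<alpha> + \<beta>) \<subseteq> {1, 2}"
    using assms keys_add[of \<alpha> \<beta>] by (auto simp: resonance_monoid_def)
  then show ?thesis
    using assms by (auto simp: resonance_monoid_def lookup_add distrib_right sum.distrib simp del: sum.insert)
qed

lemma env_ring_const: "const c \<in> env_ring \<Lambda>"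
  by (auto simp: env_ring_def const_def zero_in_resonance split: if_splits)

lemma env_ring_add: "f \<in> env_ring \<Lambda> \<Longrightarrow> g \<in> env_ring \<Lambda> \<Longrightarrow> f + g \<in> env_ring \<Lambda>"
  using keys_add[of f g] by (auto simp: env_ring_def)

lemma env_ring_mult: "f \<in> env_ring \<Lambda> \<Longrightarrow> g \<in> env_ring \<Lambda> \<Longrightarrow> f * g \<in> env_ring \<Lambda>"
  using keys_mult[of f g] by (fastforce simp: env_ring_def intro: add_in_resonance)

lemma env_proj_in_env_points: "env_proj \<Lambda> w \<in> env_points \<Lambda>"
  by (auto simp: env_points_def env_proj_def env_ring_const env_ring_add env_ring_mult
      eval_mpoly_add eval_mpoly_mult) (simp add: const_def eval_mpoly_single)

lemma pairing_add: "pairing l (s + t) = pairing l s + pairing l t"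
  by (simp add: pairing_def distrib_left sum.distrib)

lemma pairing_nu: "pairing (nu \<Lambda> \<alpha>) t = (\<Sum>j\<in>{1, 2}. of_nat (Poly_Mapping.lookup \<alpha> j) * pairing (\<Lambda> j) t)"
  by (simp add: nu_def pairing_def UNIV_2 algebra_simps)

lemma nu_coset_rcoset:
  assumes "\<alpha> \<in> resonance_monoid \<Lambda>"
  shows "nu_coset \<Lambda> \<alpha> (isotropy \<Lambda> #>\<^bsub>period_lattice \<Lambda>\<^esub> t) = pairing (nu \<Lambda> \<alpha>) t"
proof -
  have "pairing (nu \<Lambda> \<alpha>) h = 0" if "h \<in> isotropy \<Lambda>" for h
    using assms that by (auto simp: pairing_nu resonance_monoid_def residual_weight_def)
  moreover have "0 \<in> isotropy \<Lambda>" by (simp add: isotropy_def pairing_def)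
  ultimately have "pairing (nu \<Lambda> \<alpha>) ` (isotropy \<Lambda> #>\<^bsub>period_lattice \<Lambda>\<^esub> t) = {pairing (nu \<Lambda> \<alpha>) t}"
    by (force simp: r_coset_def period_lattice_def pairing_add)
  then show ?thesis by (simp add: nu_coset_def)
qed

text \<open>The envelope monodromy is induced by the diagonal action on the slice \<open>z\<^sub>0 = 1\<close>.\<close>

lemma env_act_env_proj:
  assumes "t \<in> carrier (period_lattice \<Lambda>)"
  shows "env_act \<Lambda> (isotropy \<Lambda> #>\<^bsub>period_lattice \<Lambda>\<^esub> t) (env_proj \<Lambda> w) = env_proj \<Lambda> (diag_action \<Lambda> t w)"
proof -
  let ?\<gamma> = "isotropy \<Lambda> #>\<^bsub>period_lattice \<Lambda>\<^esub> t"
  have \<gamma>: "?\<gamma> \<in> carrier (period_group \<Lambda>)"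
    using assms by (auto simp: period_group_def carrier_FactGroup)
  have "eval_mpoly w (env_monodromy \<Lambda> ?\<gamma> p) = eval_mpoly (diag_action \<Lambda> t w) p"
    and "env_monodromy \<Lambda> ?\<gamma> p \<in> env_ring \<Lambda>" if p: "p \<in> env_ring \<Lambda>" for p
  proof -
    let ?m = "Poly_Mapping.mapp (\<lambda>\<alpha> c. exp (nu_coset \<Lambda> \<alpha> ?\<gamma>) * c) p"
    have m: "env_monodromy \<Lambda> ?\<gamma> p = ?m" using \<gamma> p by (simp add: env_monodromy_def)
    have k: "Poly_Mapping.keys ?m \<subseteq> Poly_Mapping.keys p" by (rule keys_mapp_subset)
    then show "env_monodromy \<Lambda> ?\<gamma> p \<in> env_ring \<Lambda>" using p m by (auto simp: env_ring_def)
    have u3: "(UNIV :: 3 set) = {0, 1, 2}"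
      by (rule sym, rule card_subset_eq) auto
    have "(\<Prod>j\<in>UNIV. (diag_action \<Lambda> t w $ j) ^ Poly_Mapping.lookup \<alpha> j)
          = exp (nu_coset \<Lambda> \<alpha> ?\<gamma>) * (\<Prod>j\<in>UNIV. (w $ j) ^ Poly_Mapping.lookup \<alpha> j)"
      if "\<alpha> \<in> Poly_Mapping.keys p" for \<alpha>
    proof -
      have \<alpha>: "\<alpha> \<in> resonance_monoid \<Lambda>" using that p by (auto simp: env_ring_def)
      then have \<alpha>0: "Poly_Mapping.lookup \<alpha> 0 = 0"
        by (auto simp: resonance_monoid_def in_keys_iff)
      have "exp (nu_coset \<Lambda> \<alpha> ?\<gamma>) = exp (pairing (\<Lambda> 1) t) ^ Poly_Mapping.lookup \<alpha> 1 *
              exp (pairing (\<Lambda> 2) t) ^ Poly_Mapping.lookup \<alpha> 2"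
        unfolding nu_coset_rcoset[OF \<alpha>] pairing_nu by (simp add: exp_add flip: exp_of_nat_mult)
      then show ?thesis
        unfolding u3 by (simp add: \<alpha>0 diag_action_def power_mult_distrib)
    qed
    then show "eval_mpoly w (env_monodromy \<Lambda> ?\<gamma> p) = eval_mpoly (diag_action \<Lambda> t w) p"
      unfolding m by (subst eval_mpoly_superset[OF finite_keys k])
        (auto simp: eval_mpoly_def lookup_mapp intro!: sum.cong)
  qed
  then show ?thesis
    using \<gamma> env_proj_in_env_points[of \<Lambda> w]
    unfolding env_act_def by (simp add: env_proj_def cong: restrict_cong)
qed


section \<open>Action groupoids and quotient stacks\<close>

text \<open>
  In this section a discrete group \<open>G\<close> acts, through \<open>act\<close>, on an affine variety with set of points
  \<open>Q\<close> and algebra \<open>R\<close> of regular functions on \<open>Q\<close>.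
\<close>

text \<open>
  The space of arrows \<open>G \<times> Q\<close> is the disjoint union of copies of \<open>Q\<close> indexed by \<open>G\<close>.
  \<open>gcomp y x\<close> is the composite of \<open>x\<close> followed by \<open>y\<close>.
\<close>

record ('o, 'a) groupoid =
  gobj :: "'o set"
  gobj_fun :: "('o \<Rightarrow> complex) set"
  garr :: "'a set"
  garr_fun :: "('a \<Rightarrow> complex) set"
  gsrc :: "'a \<Rightarrow> 'o"
  gtgt :: "'a \<Rightarrow> 'o"
  gunit :: "'o \<Rightarrow> 'a"
  ginv :: "'a \<Rightarrow> 'a"
  gcomp :: "'a \<Rightarrow> 'a \<Rightarrow> 'a"

definition action_groupoid ::
  "'g monoid \<Rightarrow> 'q set \<Rightarrow> ('q \<Rightarrow> complex) set \<Rightarrow> ('g \<Rightarrow> 'q \<Rightarrow> 'q) \<Rightarrow> ('q, 'g \<times> 'q) groupoid" where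
  "action_groupoid G Q R act =
     \<lparr>gobj = Q,
      gobj_fun = R,
      garr = carrier G \<times> Q,
      garr_fun = {F \<in> extensional (carrier G \<times> Q). \<forall>g\<in>carrier G. (\<lambda>q\<in>Q. F (g, q)) \<in> R},
      gsrc = (\<lambda>(g, q)\<in>carrier G \<times> Q. q),
      gtgt = (\<lambda>(g, q)\<in>carrier G \<times> Q. act g q),
      gunit = (\<lambda>q\<in>Q. (\<one>\<^bsub>G\<^esub>, q)),
      ginv = (\<lambda>(g, q)\<in>carrier G \<times> Q. (inv\<^bsub>G\<^esub> g, act g q)),
      gcomp = (\<lambda>(h, r)\<in>carrier G \<times> Q. \<lambda>(g, q)\<in>{(g, q) \<in> carrier G \<times> Q. act g q = r}.
                 (h \<otimes>\<^bsub>G\<^esub> g, q))\<rparr>"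

text \<open>
  The quotient stack is taken over the site of complex spaces with functions, with open coverings:
  topological spaces with a sheaf of algebras of continuous complex-valued functions in which
  nowhere vanishing functions are invertible. Complex manifolds and reduced complex analytic spaces
  are full subcategories.
\<close>

record 't fspace =
  fs_top :: "'t topology"
  fs_fun :: "'t set \<Rightarrow> ('t \<Rightarrow> complex) set"

abbreviation fs_points :: "'t fspace \<Rightarrow> 't set" where
  "fs_points T \<equiv> topspace (fs_top T)"

definition complex_fspace :: "'t fspace \<Rightarrow> bool" where
  "complex_fspace T \<longleftrightarrow>
     (\<forall>U. openin (fs_top T) U \<longrightarrow>
        fs_fun T U \<subseteq> {f \<in> extensional U. continuous_map (subtopology (fs_top T) U) euclidean f} \<and>
        (\<forall>c. (\<lambda>x\<in>U. c) \<in> fs_fun T U) \<and>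
        (\<forall>f\<in>fs_fun T U. \<forall>g\<in>fs_fun T U.
           (\<lambda>x\<in>U. f x + g x) \<in> fs_fun T U \<and> (\<lambda>x\<in>U. f x * g x) \<in> fs_fun T U) \<and>
        (\<forall>f\<in>fs_fun T U. (\<forall>x\<in>U. f x \<noteq> 0) \<longrightarrow> (\<lambda>x\<in>U. inverse (f x)) \<in> fs_fun T U) \<and>
        (\<forall>f\<in>fs_fun T U. \<forall>V. openin (fs_top T) V \<and> V \<subseteq> U \<longrightarrow> restrict f V \<in> fs_fun T V) \<and>
        (\<forall>f\<in>extensional U.
           (\<forall>x\<in>U. \<exists>V. openin (fs_top T) V \<and> x \<in> V \<and> V \<subseteq> U \<and> restrict f V \<in> fs_fun T V) \<longrightarrow>
           f \<in> fs_fun T U))"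

definition fs_mor :: "'s fspace \<Rightarrow> 't fspace \<Rightarrow> ('s \<Rightarrow> 't) set" where
  "fs_mor S T =
     {h \<in> extensional (fs_points S). continuous_map (fs_top S) (fs_top T) h \<and>
        (\<forall>U g. openin (fs_top T) U \<and> g \<in> fs_fun T U \<longrightarrow>
           (\<lambda>x\<in>{x \<in> fs_points S. h x \<in> U}. g (h x)) \<in> fs_fun S {x \<in> fs_points S. h x \<in> U})}"

definition fs_iso :: "'s fspace \<Rightarrow> 't fspace \<Rightarrow> ('s \<Rightarrow> 't) set" where
  "fs_iso S T =
     {h \<in> fs_mor S T. \<exists>k\<in>fs_mor T S.
        (\<forall>x\<in>fs_points S. k (h x) = x) \<and> (\<forall>y\<in>fs_points T. h (k y) = y)}"

text \<open>Only used for open \<open>U\<close>, where every open subset of \<open>U\<close> is open in \<open>T\<close>.\<close>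

definition fs_open_sub :: "'t fspace \<Rightarrow> 't set \<Rightarrow> 't fspace" where
  "fs_open_sub T U = T\<lparr>fs_top := subtopology (fs_top T) U\<rparr>"

text \<open>
  A \<open>G\<close>-torsor over \<open>T\<close>: over suitable open sets \<open>U\<close> covering \<open>T\<close>, the preimage of \<open>U\<close> is the
  disjoint union of the \<open>G\<close>-translates of an open set \<open>V\<close> that projects isomorphically to \<open>U\<close>.
\<close>

definition torsor ::
  "'g monoid \<Rightarrow> 't fspace \<Rightarrow> 'p fspace \<Rightarrow> ('p \<Rightarrow> 't) \<Rightarrow> ('g \<Rightarrow> 'p \<Rightarrow> 'p) \<Rightarrow> bool" where
  "torsor G T P \<pi> m \<longleftrightarrow>
     complex_fspace P \<and> \<pi> \<in> fs_mor P T \<and>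
     m \<in> extensional (carrier G) \<and>
     (\<forall>g\<in>carrier G. m g \<in> fs_mor P P \<and> (\<forall>p\<in>fs_points P. \<pi> (m g p) = \<pi> p)) \<and>
     (\<forall>p\<in>fs_points P. m \<one>\<^bsub>G\<^esub> p = p) \<and>
     (\<forall>g\<in>carrier G. \<forall>h\<in>carrier G. \<forall>p\<in>fs_points P. m (g \<otimes>\<^bsub>G\<^esub> h) p = m g (m h p)) \<and>
     (\<forall>x\<in>fs_points T. \<exists>U V.
        openin (fs_top T) U \<and> x \<in> U \<and> openin (fs_top P) V \<and>
        restrict \<pi> V \<in> fs_iso (fs_open_sub P V) (fs_open_sub T U) \<and>
        {p \<in> fs_points P. \<pi> p \<in> U} = (\<Union>g\<in>carrier G. m g ` V) \<and>
        disjoint_family_on (\<lambda>g. m g ` V) (carrier G))"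

text \<open>
  Objects of \<open>[Q/G]\<close> over \<open>T\<close>: a \<open>G\<close>-torsor on \<open>T\<close> with an equivariant morphism to \<open>Q\<close>, a
  morphism to the affine variety \<open>Q\<close> being a map that pulls regular functions back to sections of
  the structure sheaf. The points of all bases are taken in the type \<open>'t\<close> and those of all torsors
  in the type \<open>'p\<close>, both arbitrary.
\<close>

record ('t, 'p, 'g, 'q) stack_obj =
  so_base :: "'t fspace"
  so_total :: "'p fspace"
  so_proj :: "'p \<Rightarrow> 't"
  so_act :: "'g \<Rightarrow> 'p \<Rightarrow> 'p"
  so_map :: "'p \<Rightarrow> 'q"

definition stack_objects ::
  "'g monoid \<Rightarrow> 'q set \<Rightarrow> ('q \<Rightarrow> complex) set \<Rightarrow> ('g \<Rightarrow> 'q \<Rightarrow> 'q) \<Rightarrow> ('t, 'p, 'g, 'q) stack_obj set" where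
  "stack_objects G Q R act =
     {x. complex_fspace (so_base x) \<and>
         torsor G (so_base x) (so_total x) (so_proj x) (so_act x) \<and>
         so_map x \<in> fs_points (so_total x) \<rightarrow>\<^sub>E Q \<and>
         (\<forall>f\<in>R. (\<lambda>p\<in>fs_points (so_total x). f (so_map x p))
                  \<in> fs_fun (so_total x) (fs_points (so_total x))) \<and>
         (\<forall>g\<in>carrier G. \<forall>p\<in>fs_points (so_total x). so_map x (so_act x g p) = act g (so_map x p))}"

text \<open>
  A morphism \<open>x \<rightarrow> y\<close> over \<open>f\<close> is an equivariant map \<open>u\<close> of torsors covering \<open>f\<close> and compatible
  with the maps to \<open>Q\<close>; it automatically identifies the torsor of \<open>x\<close> with the pullback by \<open>f\<close>
  of that of \<open>y\<close>. The functor to the site is \<open>x \<mapsto> so_base x\<close>, \<open>(f, u) \<mapsto> f\<close>.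
\<close>

definition stack_hom ::
  "'g monoid \<Rightarrow> ('t, 'p, 'g, 'q) stack_obj \<Rightarrow> ('t, 'p, 'g, 'q) stack_obj \<Rightarrow> (('t \<Rightarrow> 't) \<times> ('p \<Rightarrow> 'p)) set" where
  "stack_hom G x y =
     {(f, u). f \<in> fs_mor (so_base x) (so_base y) \<and> u \<in> fs_mor (so_total x) (so_total y) \<and>
        (\<forall>p\<in>fs_points (so_total x).
           so_proj y (u p) = f (so_proj x p) \<and>
           so_map y (u p) = so_map x p \<and>
           (\<forall>g\<in>carrier G. u (so_act x g p) = so_act y g (u p)))}"

record ('o, 'm, 'b, 'n) fibred_category =
  fc_obj :: "'o set"
  fc_hom :: "'o \<Rightarrow> 'o \<Rightarrow> 'm set"
  fc_id :: "'o \<Rightarrow> 'm"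
  fc_comp :: "'o \<Rightarrow> 'm \<Rightarrow> 'm \<Rightarrow> 'm"
  fc_base :: "'o \<Rightarrow> 'b"
  fc_base_mor :: "'m \<Rightarrow> 'n"

type_synonym ('t, 'p, 'g, 'q) stack =
  "(('t, 'p, 'g, 'q) stack_obj, ('t \<Rightarrow> 't) \<times> ('p \<Rightarrow> 'p), 't fspace, 't \<Rightarrow> 't) fibred_category"

text \<open>In \<open>fc_comp x n m\<close> the object \<open>x\<close> is the source of \<open>m\<close>, and \<open>m\<close> is applied first.\<close>

definition quotient_stack ::
  "'g monoid \<Rightarrow> 'q set \<Rightarrow> ('q \<Rightarrow> complex) set \<Rightarrow> ('g \<Rightarrow> 'q \<Rightarrow> 'q) \<Rightarrow> ('t, 'p, 'g, 'q) stack" where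
  "quotient_stack G Q R act =
     \<lparr>fc_obj = stack_objects G Q R act,
      fc_hom = (\<lambda>x\<in>stack_objects G Q R act. \<lambda>y\<in>stack_objects G Q R act. stack_hom G x y),
      fc_id = (\<lambda>x\<in>stack_objects G Q R act.
                 (\<lambda>t\<in>fs_points (so_base x). t, \<lambda>p\<in>fs_points (so_total x). p)),
      fc_comp = (\<lambda>x\<in>stack_objects G Q R act. \<lambda>(f', u') (f, u).
                   (compose (fs_points (so_base x)) f' f, compose (fs_points (so_total x)) u' u)),
      fc_base = so_base,
      fc_base_mor = fst\<rparr>"

definition env_groupoid ::
  "weights \<Rightarrow> (mpoly3 \<Rightarrow> complex, (complex^2) set \<times> (mpoly3 \<Rightarrow> complex)) groupoid" where
  "env_groupoid \<Lambda> =
     action_groupoid (period_group \<Lambda>) (env_points \<Lambda>) (env_functions \<Lambda>) (env_act \<Lambda>)"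

definition env_stack :: "weights \<Rightarrow> ('t, 'p, (complex^2) set, mpoly3 \<Rightarrow> complex) stack" where
  "env_stack \<Lambda> =
     quotient_stack (period_group \<Lambda>) (env_points \<Lambda>) (env_functions \<Lambda>) (env_act \<Lambda>)"


section \<open>The logarithmic connection\<close>

definition c0 :: "weights \<Rightarrow> (3 \<Rightarrow>\<^sub>0 nat) \<Rightarrow> complex" where
  "c0 \<Lambda> \<alpha> = (THE c. nu \<Lambda> \<alpha> = c *s \<Lambda> 0)"

definition delta0 :: "weights \<Rightarrow> mpoly3 \<Rightarrow> mpoly3" where
  "delta0 \<Lambda> p = Poly_Mapping.mapp (\<lambda>\<alpha> c. c0 \<Lambda> \<alpha> * c) p"

text \<open>Sections over the open set \<open>U\<close> of \<open>\<O> \<otimes> \<complex>[S\<^sub>I]\<close>: finite sums of \<open>f\<^sub>\<alpha> X\<^sup>\<alpha>\<close>, \<open>f\<^sub>\<alpha>\<close> holomorphic.\<close>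

definition env_sections :: "weights \<Rightarrow> complex set \<Rightarrow> (complex \<Rightarrow> mpoly3) set" where
  "env_sections \<Lambda> U =
     {s \<in> U \<rightarrow>\<^sub>E env_ring \<Lambda>. finite (\<Union>z\<in>U. Poly_Mapping.keys (s z)) \<and>
        (\<forall>\<alpha>. (\<lambda>z. Poly_Mapping.lookup (s z) \<alpha>) holomorphic_on U)}"

definition coeff_deriv :: "(complex \<Rightarrow> mpoly3) \<Rightarrow> complex \<Rightarrow> mpoly3" where
  "coeff_deriv s z = Abs_poly_mapping (\<lambda>\<alpha>. deriv (\<lambda>u. Poly_Mapping.lookup (s u) \<alpha>) z)"

text \<open>\<open>\<nabla>\<^sub>I\<close> on sections over \<open>\<complex>\<^sup>*\<close>; the one-form \<open>\<nabla>\<^sub>I s\<close> is given by its coefficient of \<open>dz\<^sub>0\<close>.\<close>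

definition log_connection :: "weights \<Rightarrow> (complex \<Rightarrow> mpoly3) \<Rightarrow> (complex \<Rightarrow> mpoly3)" where
  "log_connection \<Lambda> =
     (\<lambda>s\<in>env_sections \<Lambda> (- {0}). \<lambda>z\<in>- {0}. coeff_deriv s z - const (1 / z) * delta0 \<Lambda> (s z))"


section \<open>The foliation and its Camacho--Sad index\<close>

text \<open>
  The vector field \<open>t \<partial>/\<partial>t + \<delta>\<^sub>0\<close> on \<open>\<Delta>\<^sub>0 \<times> Q\<^sub>I\<close>, as a derivation of functions
  \<open>t \<mapsto> s t \<in> \<complex>[S\<^sub>I]\<close>.
\<close>

definition fol_field :: "weights \<Rightarrow> (complex \<Rightarrow> mpoly3) \<Rightarrow> complex \<Rightarrow> mpoly3" where
  "fol_field \<Lambda> s t = const t * coeff_deriv s t + delta0 \<Lambda> (s t)"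

text \<open>
  Its components along \<open>\<partial>/\<partial>t\<close> and \<open>\<partial>/\<partial>x\<close> in the chart \<open>(t, x = X)\<close> are the values of the
  derivation on the coordinate functions \<open>t\<close> and \<open>X\<close>.
\<close>

definition env_point :: "weights \<Rightarrow> complex \<Rightarrow> (mpoly3 \<Rightarrow> complex)" where
  "env_point \<Lambda> = the_inv_into (env_points \<Lambda>) env_coord"

definition fol_A :: "weights \<Rightarrow> complex \<Rightarrow> complex \<Rightarrow> complex" where
  "fol_A \<Lambda> t x = env_point \<Lambda> x (fol_field \<Lambda> const t)"

definition fol_B :: "weights \<Rightarrow> complex \<Rightarrow> complex \<Rightarrow> complex" where
  "fol_B \<Lambda> t x = env_point \<Lambda> x (fol_field \<Lambda> (\<lambda>_. env_X) t)"

text \<open>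
  For a foliation generated by \<open>A \<partial>/\<partial>t + B \<partial>/\<partial>x\<close> near the origin, and the curve \<open>x = 0\<close>. In the
  chart \<open>(t, X)\<close> of \<open>\<Delta>\<^sub>0 \<times> Q\<^sub>I\<close> this curve is \<open>\<Delta>\<^sub>0 \<times> {o\<^sub>I}\<close>.
\<close>

definition invariant_axis ::
  "(complex \<Rightarrow> complex \<Rightarrow> complex) \<Rightarrow> (complex \<Rightarrow> complex \<Rightarrow> complex) \<Rightarrow> bool" where
  "invariant_axis A B \<longleftrightarrow> (\<forall>\<^sub>F t in nhds 0. B t 0 = 0)"

definition camacho_sad_index ::
  "(complex \<Rightarrow> complex \<Rightarrow> complex) \<Rightarrow> (complex \<Rightarrow> complex \<Rightarrow> complex) \<Rightarrow> complex" where
  "camacho_sad_index A B = residue (\<lambda>t. deriv (\<lambda>x. B t x / A t x) 0) 0"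

definition env_cs_index :: "weights \<Rightarrow> complex" where
  "env_cs_index \<Lambda> = camacho_sad_index (fol_A \<Lambda>) (fol_B \<Lambda>)"

end

theory Submission
  imports Defs
begin

text \<open>
  On the isotropy \<open>t\<^sub>1 = 0\<close> the weights \<open>\<Lambda>\<^sub>1, \<Lambda>\<^sub>2\<close> restrict to \<open>\<plusminus>t\<^sub>2\<close>, so the resonances are the multiples of
  \<open>(1,1)\<close> and the envelope is the affine line with coordinate \<open>X\<close>, for every \<open>N\<close>. On \<open>X\<^sup>n\<close> one has
  \<open>\<nu> = n (a + b + N) \<Lambda>\<^sub>0\<close>. Periods take values of \<open>\<Lambda>\<^sub>0\<close> in \<open>2\<pi>\<i>\<int>\<close>, so the monodromy, which
  exponentiates \<open>\<nu>\<close>, forgets \<open>N\<close>; the operator \<open>\<delta>\<^sub>0\<close>, hence the connection and the residue of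
  \<open>(a + b + N) dt/t\<close>, remembers it.
\<close>

section \<open>Weights in coordinates: maximal rank and the Poincare domain\<close>

lemma UNIV_three: "(UNIV :: 3 set) = {0, 1, 2}"
  by (rule sym, rule card_subset_eq) auto

lemma pairing_2: "pairing l t = l $ 1 * t $ 1 + l $ 2 * t $ 2"
  by (simp add: pairing_def UNIV_2)

lemma weights_family_nth:
  "weights_family a b N 0 = vector [1, 0]"
  "weights_family a b N 1 = vector [a + of_nat N, 1]"
  "weights_family a b N 2 = vector [b, -1]"
  by (simp_all add: weights_family_def)

lemma vec_2_eq_iff: "(x :: 'a^2) = y \<longleftrightarrow> x $ 1 = y $ 1 \<and> x $ 2 = y $ 2"
  by (simp add: vec_eq_iff forall_2)

text \<open>The determinant vanishes as soon as \<open>x\<close> is a multiple of \<open>y\<close>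
  or \<open>y\<close> is zero, so a nonzero value puts \<open>x\<close> outside the line spanned by
  \<open>y\<close>.\<close>

lemma independent_pair:
  fixes x y :: "complex^2"
  assumes det: "x $ 1 * y $ 2 - x $ 2 * y $ 1 \<noteq> 0"
  shows "vec.independent {x, y}" and "x \<noteq> y"
proof -
  show "x \<noteq> y"
    using det by (auto simp: mult.commute)
  have y0: "y \<noteq> 0"
    using det by auto
  have "x \<noteq> k *s y" for k
    using det by auto
  then have "x \<notin> vec.span {y}"
    by (auto simp: vec.span_singleton)
  then show "vec.independent {x, y}"
    using y0 by (simp add: vec.independent_insert)
qed

text \<open>Every set of at most two indices lies in a pair of distinct ones, and independence
  passes to subsets, so the 2x2 minors decide the matter.\<close>

lemma uniform_maximal_rankI:
  fixes \<Lambda> :: weights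
  assumes det: "\<And>i j. i \<noteq> j \<Longrightarrow> \<Lambda> i $ 1 * \<Lambda> j $ 2 - \<Lambda> i $ 2 * \<Lambda> j $ 1 \<noteq> 0"
  shows "uniform_maximal_rank \<Lambda>"
  unfolding uniform_maximal_rank_def
proof (intro allI impI conjI)
  fix K :: "3 set"
  assume K: "card K \<le> 2"
  show "inj_on \<Lambda> K"
    using independent_pair(2)[OF det] by (auto simp: inj_on_def)
  obtain i j where ij: "i \<noteq> j" "K \<subseteq> {i, j}"
  proof -
    from K consider "card K = 0" | "card K = 1" | "card K = 2"
      by linarith
    then show ?thesis
    proof cases
      case 1
      then show ?thesis using that[of 0 1] by simp
    next
      case 2
      then obtain k where "K = {k}" by (auto simp: card_1_singleton_iff)
      \<comment> \<open>Arithmetic in the index type is modulo 3, so \<open>k + 1\<close> is an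
        index other than \<open>k\<close>.\<close>
      then show ?thesis using that[of k "k + 1"] by auto
    next
      case 3
      then show ?thesis using that by (auto simp: card_2_iff)
    qed
  qed
  then show "vec.independent (\<Lambda> ` K)"
    using independent_pair(1)[OF det[OF ij(1)]] by (rule_tac vec.independent_mono) auto
qed

text \<open>Up to sign the minors are 1, 1 and \<open>a + b + N\<close>; the last is nonzero because
  its real part is positive.\<close>

lemma uniform_maximal_rank_weights_family:
  assumes "Re a > 0" "Re b > 0"
  shows "uniform_maximal_rank (weights_family a b N)"
proof (rule uniform_maximal_rankI)
  have "Re (a + b + of_nat N) > 0"
    using assms by simp
  then have ne: "a + b + of_nat N \<noteq> 0"
    by (metis zero_complex.sel(1) less_irrefl)
  moreover have "- a - of_nat N - b = - (a + b + of_nat N)"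
    by simp
  ultimately have ne': "- a - of_nat N - b \<noteq> 0"
    by (metis neg_equal_0_iff_equal)
  fix i j :: 3
  assume "i \<noteq> j"
  moreover have "i \<in> {0, 1, 2}" "j \<in> {0, 1, 2}"
    by (simp_all flip: UNIV_three)
  ultimately show "weights_family a b N i $ 1 * weights_family a b N j $ 2
      - weights_family a b N i $ 2 * weights_family a b N j $ 1 \<noteq> 0"
    using ne ne' by (auto simp: weights_family_def add_ac)
qed

lemma poincare_domain_weights_family:
  assumes "Re a > 0" "Re b > 0"
  shows "poincare_domain (weights_family a b N)"
  unfolding poincare_domain_def
  \<comment> \<open>Pairing with (1, 0) picks out the first coefficients 1, \<open>a + N\<close> and
    \<open>b\<close>.\<close>
  by (rule exI[of _ "vector [1, 0]"]) (use assms in \<open>auto simp: pairing_2 weights_family_def\<close>)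

section \<open>Isotropy, residual weights and resonances\<close>

lemma isotropy_weights_family: "isotropy (weights_family a b N) = {t. t $ 1 = 0}"
  by (simp add: isotropy_def pairing_2 weights_family_nth)

lemma residual_weight_weights_family:
  "residual_weight (weights_family a b N) 1 = (\<lambda>t\<in>{t. t $ 1 = 0}. 1 * t $ 2)"
  "residual_weight (weights_family a b N) 2 = (\<lambda>t\<in>{t. t $ 1 = 0}. - 1 * t $ 2)"
  by (auto simp: residual_weight_def isotropy_weights_family pairing_2 weights_family_nth
      cong: restrict_cong)

text \<open>The exponent of \<open>X^n\<close>, where \<open>X\<close> is the product of the two
  transverse variables.\<close>

definition diag_exponent :: "nat \<Rightarrow> 3 \<Rightarrow>\<^sub>0 nat" where
  "diag_exponent n = Poly_Mapping.single 1 n + Poly_Mapping.single 2 n"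

lemma lookup_diag_exponent:
  "Poly_Mapping.lookup (diag_exponent n) j = (if j = 0 then 0 else n)"
proof -
  have "j \<in> {0, 1, 2}"
    by (simp flip: UNIV_three)
  then show ?thesis
    by (auto simp: diag_exponent_def lookup_add lookup_single)
qed

lemma inj_diag_exponent: "inj diag_exponent"
  by (rule injI) (metis lookup_diag_exponent zero_neq_one)

lemma diag_exponent_0 [simp]: "diag_exponent 0 = 0"
  by (simp add: diag_exponent_def)

lemma diag_exponent_add: "diag_exponent (m + n) = diag_exponent m + diag_exponent n"
  by (simp add: diag_exponent_def single_add add_ac)

lemma resonance_monoid_weights_family:
  "resonance_monoid (weights_family a b N) = range diag_exponent"
proof (intro equalityI subsetI)
  fix \<alpha> assume \<alpha>: "\<alpha> \<in> resonance_monoid (weights_family a b N)"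
  \<comment> \<open>The vector (0, 1) spans the isotropy and the residual weights take the values 1
    and -1 on it, so the resonance relation there forces equal exponents.\<close>
  have "vector [0, 1] \<in> isotropy (weights_family a b N)"
    by (simp add: isotropy_weights_family)
  with \<alpha> have "(\<Sum>j\<in>{1, 2}. of_nat (Poly_Mapping.lookup \<alpha> j)
      * residual_weight (weights_family a b N) j (vector [0, 1])) = 0"
    unfolding resonance_monoid_def by blast
  then have "of_nat (Poly_Mapping.lookup \<alpha> 1) = (of_nat (Poly_Mapping.lookup \<alpha> 2) :: complex)"
    by (simp add: residual_weight_weights_family)
  moreover have "Poly_Mapping.lookup \<alpha> 0 = 0"
    using \<alpha> by (auto simp: resonance_monoid_def in_keys_iff)
  ultimately have "Poly_Mapping.lookup \<alpha> j = Poly_Mapping.lookup (diag_exponent (Poly_Mapping.lookup \<alpha> 1)) j"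
    if "j = 0 \<or> j = 1 \<or> j = 2" for j
    using that unfolding lookup_diag_exponent by auto
  moreover have "j = 0 \<or> j = 1 \<or> j = 2" for j :: 3
    using UNIV_three by auto
  ultimately have "\<alpha> = diag_exponent (Poly_Mapping.lookup \<alpha> 1)"
    by (intro poly_mapping_eqI) blast
  then show "\<alpha> \<in> range diag_exponent"
    by blast
next
  fix \<alpha> assume "\<alpha> \<in> range diag_exponent"
  then obtain n where "\<alpha> = diag_exponent n" by blast
  moreover have "Poly_Mapping.keys (diag_exponent n) \<subseteq> {1, 2}"
  proof
    fix j assume "j \<in> Poly_Mapping.keys (diag_exponent n)"
    then have "j \<noteq> 0"
      by (auto simp: in_keys_iff lookup_diag_exponent)
    moreover have "j \<in> {0, 1, 2}"
      by (simp flip: UNIV_three)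
    ultimately show "j \<in> {1, 2}"
      by blast
  qed
  ultimately show "\<alpha> \<in> resonance_monoid (weights_family a b N)"
    by (auto simp: resonance_monoid_def residual_weight_weights_family isotropy_weights_family
        lookup_diag_exponent)
qed

section \<open>The envelope as an affine line\<close>

lemma env_X_eq_single: "env_X = Poly_Mapping.single (diag_exponent 1) 1"
  by (simp add: env_X_def wvar_def mult_single diag_exponent_def)

lemma env_X_power: "env_X ^ n = Poly_Mapping.single (diag_exponent n) 1"
proof (induction n)
  case (Suc n)
  then show ?case
    by (simp add: env_X_eq_single mult_single flip: diag_exponent_add)
qed simp

lemma const_0 [simp]: "const 0 = 0"
  by (simp add: const_def)

lemma const_mult_single: "const c * Poly_Mapping.single \<alpha> d = Poly_Mapping.single \<alpha> (c * d)"
  by (simp add: const_def mult_single)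

lemma const_inject [simp]: "const c = const d \<longleftrightarrow> c = d"
  by (auto simp: const_def dest: arg_cong[where f = "\<lambda>p. Poly_Mapping.lookup p 0"])

lemma poly_const_env_X:
  "poly (map_poly const p) env_X
     = (\<Sum>i\<le>degree p. Poly_Mapping.single (diag_exponent i) (coeff p i))"
proof -
  have "degree (map_poly const p) = degree p"
    by (rule degree_map_poly) (metis const_0 const_inject)
  then show ?thesis
    by (simp add: poly_altdef coeff_map_poly env_X_power const_mult_single)
qed

text \<open>Distinct powers of \<open>X\<close> have distinct exponents, so the coefficients of
  \<open>p\<close> can be read back; this makes substitution of \<open>X\<close> injective.\<close>

lemma lookup_poly_const_env_X:
  "Poly_Mapping.lookup (poly (map_poly const p) env_X) (diag_exponent n) = coeff p n"
proof -
  have "Poly_Mapping.lookup (poly (map_poly const p) env_X) (diag_exponent n)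
          = (\<Sum>i\<le>degree p. if i = n then coeff p i else 0)"
    unfolding poly_const_env_X lookup_sum lookup_single when_def
    using inj_diag_exponent by (intro sum.cong) (auto simp: inj_eq)
  also have "\<dots> = coeff p n"
    by (auto simp: coeff_eq_0)
  finally show ?thesis .
qed

lemma keys_poly_const_env_X:
  "Poly_Mapping.keys (poly (map_poly const p) env_X) \<subseteq> range diag_exponent"
proof
  fix \<alpha> assume \<alpha>: "\<alpha> \<in> Poly_Mapping.keys (poly (map_poly const p) env_X)"
  show "\<alpha> \<in> range diag_exponent"
  proof (rule ccontr)
    assume "\<alpha> \<notin> range diag_exponent"
    then have "Poly_Mapping.lookup (poly (map_poly const p) env_X) \<alpha> = 0"
      unfolding poly_const_env_X lookup_sum lookup_single when_def
      by (intro sum.neutral) auto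
    with \<alpha> show False
      by (simp add: in_keys_iff)
  qed
qed

text \<open>All exponents in the ring are those of powers of \<open>X\<close>, so each element is a
  polynomial in \<open>X\<close>, and only one.\<close>

lemma bij_betw_poly_env_ring:
  "bij_betw (\<lambda>p::complex poly. poly (map_poly const p) env_X) UNIV (env_ring (weights_family a b N))"
proof (rule bij_betwI')
  show "poly (map_poly const p) env_X = poly (map_poly const q) env_X \<longleftrightarrow> p = q" for p q
    by (metis lookup_poly_const_env_X poly_eqI)
  show "poly (map_poly const p) env_X \<in> env_ring (weights_family a b N)" for p
    using keys_poly_const_env_X by (simp add: env_ring_def resonance_monoid_weights_family)
  fix f assume "f \<in> env_ring (weights_family a b N)"
  then have f: "Poly_Mapping.keys f \<subseteq> range diag_exponent"
    by (simp add: env_ring_def resonance_monoid_weights_family)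
  \<comment> \<open>Finite support of \<open>f\<close> and injectivity of
    \<open>diag_exponent\<close> leave finitely many nonzero coefficients, as
    \<open>Abs_poly\<close> requires.\<close>
  have "finite (diag_exponent -` Poly_Mapping.keys f)"
    using inj_diag_exponent by (intro finite_vimageI) auto
  then have "finite {n. Poly_Mapping.lookup f (diag_exponent n) \<noteq> 0}"
    by (simp add: vimage_def in_keys_iff)
  then have c: "coeff (Abs_poly (\<lambda>n. Poly_Mapping.lookup f (diag_exponent n))) n
      = Poly_Mapping.lookup f (diag_exponent n)" for n
    by (subst Abs_poly_inverse) (auto simp: MOST_iff_cofinite)
  have "f = poly (map_poly const (Abs_poly (\<lambda>n. Poly_Mapping.lookup f (diag_exponent n)))) env_X"
    (is "f = ?g")
  proof (rule poly_mapping_eqI)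
    fix \<alpha>
    show "Poly_Mapping.lookup f \<alpha> = Poly_Mapping.lookup ?g \<alpha>"
    proof (cases "\<alpha> \<in> range diag_exponent")
      case True
      then show ?thesis by (auto simp: lookup_poly_const_env_X c)
    next
      case False
      then show ?thesis
        using f keys_poly_const_env_X by (metis in_keys_iff subsetD)
    qed
  qed
  then show "\<exists>p\<in>UNIV. f = poly (map_poly const p) env_X"
    by blast
qed

lemma env_X_in_env_ring: "env_X \<in> env_ring (weights_family a b N)"
  by (simp add: env_ring_def resonance_monoid_weights_family env_X_eq_single)

lemma env_point_hom:
  assumes "q \<in> env_points \<Lambda>"
  shows "q (const c) = c"
    and "f \<in> env_ring \<Lambda> \<Longrightarrow> g \<in> env_ring \<Lambda> \<Longrightarrow> q (f + g) = q f + q g"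
    and "f \<in> env_ring \<Lambda> \<Longrightarrow> g \<in> env_ring \<Lambda> \<Longrightarrow> q (f * g) = q f * q g"
  using assms unfolding env_points_def by blast+

text \<open>Induction along Horner's rule, with the homomorphism laws of \<open>q\<close>. A point
  is thereby determined on the whole ring by its value at \<open>X\<close>.\<close>

lemma env_point_poly:
  assumes q: "q \<in> env_points (weights_family a b N)"
  shows "q (poly (map_poly const p) env_X) = poly p (q env_X)"
proof (induction p)
  case 0
  then show ?case
    using env_point_hom(1)[OF q, of 0] by simp
next
  case (pCons c p)
  have "poly (map_poly const p) env_X \<in> env_ring (weights_family a b N)"
    using bij_betw_poly_env_ring by (blast dest: bij_betwE)
  moreover from this have "env_X * poly (map_poly const p) env_X \<in> env_ring (weights_family a b N)"
    by (intro env_ring_mult env_X_in_env_ring)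
  moreover have "poly (map_poly const (pCons c p)) env_X
      = const c + env_X * poly (map_poly const p) env_X"
    using pCons.hyps by (simp add: map_poly_pCons)
  ultimately show ?case
    by (simp add: pCons.IH env_point_hom[OF q] env_ring_const env_X_in_env_ring)
qed

lemma env_coord_env_proj: "env_coord (env_proj (weights_family a b N) w) = w $ 1 * w $ 2"
proof -
  have "env_coord (env_proj (weights_family a b N) w) = eval_mpoly w env_X"
    by (simp add: env_coord_def env_proj_def env_X_in_env_ring)
  also have "\<dots> = w $ 1 * w $ 2"
    unfolding env_X_eq_single eval_mpoly_single UNIV_three by (simp add: lookup_diag_exponent)
  finally show ?thesis .
qed

lemma inj_on_env_coord: "inj_on env_coord (env_points (weights_family a b N))"
proof (rule inj_onI)
  fix q q'
  assume q: "q \<in> env_points (weights_family a b N)"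
    and q': "q' \<in> env_points (weights_family a b N)"
    and eq: "env_coord q = env_coord q'"
  show "q = q'"
  \<comment> \<open>Points are extensional, so it suffices to compare them on ring elements, which
    are all polynomials in \<open>X\<close>.\<close>
  proof (rule extensionalityI)
    show "q \<in> extensional (env_ring (weights_family a b N))"
      "q' \<in> extensional (env_ring (weights_family a b N))"
      using q q' by (auto simp: env_points_def)
    fix f assume "f \<in> env_ring (weights_family a b N)"
    then obtain p where "f = poly (map_poly const p) env_X"
      using bij_betw_poly_env_ring[of a b N] by (auto simp: bij_betw_def)
    then show "q f = q' f"
      using eq by (simp add: env_point_poly[OF q] env_point_poly[OF q'] env_coord_def)
  qed
qed

lemma bij_betw_env_coord: "bij_betw env_coord (env_points (weights_family a b N)) UNIV"
proof -
  have "x \<in> env_coord ` env_points (weights_family a b N)" for x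
  proof (rule image_eqI)
    \<comment> \<open>The point is the image of a vector with transverse coordinates
      \<open>x\<close> and 1, whose product is \<open>x\<close>.\<close>
    show "x = env_coord (env_proj (weights_family a b N) (\<chi> j. if j = 1 then x else 1))"
      by (simp add: env_coord_env_proj)
  qed (rule env_proj_in_env_points)
  then show ?thesis
    using inj_on_env_coord by (auto simp: bij_betw_def)
qed

text \<open>Identifies the curve through the distinguished point with the axis \<open>x = 0\<close>
  of the chart used for the index.\<close>

lemma env_coord_eq_0_iff:
  "{q \<in> env_points (weights_family a b N). env_coord q = 0} = {env_origin (weights_family a b N)}"
proof -
  have "env_origin (weights_family a b N) \<in> env_points (weights_family a b N)"
    by (simp add: env_origin_def env_proj_in_env_points)
  moreover have "env_coord (env_origin (weights_family a b N)) = 0"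
    by (simp add: env_origin_def env_coord_env_proj)
  moreover from calculation have "q = env_origin (weights_family a b N)"
    if "q \<in> env_points (weights_family a b N)" "env_coord q = 0" for q
    using inj_onD[OF inj_on_env_coord[of a b N] _ that(1)] that(2) by simp
  ultimately show ?thesis
    by blast
qed

section \<open>Independence of the envelope from \<open>N\<close>\<close>

lemma env_ring_weights_family: "env_ring (weights_family a b N) = {p. Poly_Mapping.keys p \<subseteq> range diag_exponent}"
  by (simp add: env_ring_def resonance_monoid_weights_family)

lemma env_ring_indep: "env_ring (weights_family a b N) = env_ring (weights_family a b M)"
  by (simp add: env_ring_weights_family)

lemma env_points_indep: "env_points (weights_family a b N) = env_points (weights_family a b M)"
  unfolding env_points_def env_ring_indep[of a b N M] by (rule refl)

lemma envelope_indep: "envelope (weights_family a b N) = envelope (weights_family a b M)"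
  unfolding envelope_def env_origin_def env_proj_def env_ring_indep[of a b N M]
    env_points_indep[of a b N M] by (rule refl)

section \<open>The period group\<close>

text \<open>The second coefficients 1 and -1 cancel on equal exponents, leaving a multiple of
  \<open>\<Lambda>\<^sub>0\<close>, whose factor does depend on \<open>N\<close>.\<close>

lemma nu_diag_exponent:
  "nu (weights_family a b N) (diag_exponent n) = vector [of_nat n * (a + b + of_nat N), 0]"
  by (simp add: nu_def vec_2_eq_iff lookup_diag_exponent weights_family_nth algebra_simps)

lemma carrier_period_lattice:
  "carrier (period_lattice (weights_family a b N)) = {t. \<exists>k::int. t $ 1 = 2 * pi * \<i> * of_int k}"
  by (simp add: period_lattice_def pairing_2 weights_family_nth)

lemma period_lattice_indep: "period_lattice (weights_family a b N) = period_lattice (weights_family a b M)"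
  by (simp add: period_lattice_def pairing_2 weights_family_nth)

lemma period_group_indep: "period_group (weights_family a b N) = period_group (weights_family a b M)"
  by (simp add: period_group_def isotropy_weights_family period_lattice_indep[of a b N M])

text \<open>The coset on which \<open>\<Lambda>\<^sub>0\<close> takes the value
  \<open>2 * pi * \<i> * k\<close>: a labelling of the period group by integers, common to all
  members of the family.\<close>

definition period_class :: "int \<Rightarrow> (complex^2) set" where
  "period_class k = {t. t $ 1 = 2 * pi * \<i> * of_int k}"

lemma rcoset_period_class:
  assumes "t $ 1 = 2 * pi * \<i> * of_int k"
  shows "isotropy (weights_family a b N) #>\<^bsub>period_lattice (weights_family a b N)\<^esub> t = period_class k"
proof (intro equalityI subsetI)
  fix s assume "s \<in> period_class k"
  then have "s - t \<in> isotropy (weights_family a b N)"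
    using assms by (simp add: period_class_def isotropy_weights_family)
  then show "s \<in> isotropy (weights_family a b N) #>\<^bsub>period_lattice (weights_family a b N)\<^esub> t"
    unfolding r_coset_def by (auto simp: period_lattice_def intro!: bexI[of _ "s - t"])
qed (use assms in \<open>auto simp: r_coset_def period_class_def isotropy_weights_family period_lattice_def\<close>)

lemma ex_vec_nth_1_eq: "\<exists>t :: complex^2. t $ 1 = c"
  by (rule exI[of _ "vector [c, 0]"]) simp

lemma carrier_period_group: "carrier (period_group (weights_family a b N)) = range period_class"
proof (intro equalityI subsetI)
  fix \<gamma> assume "\<gamma> \<in> carrier (period_group (weights_family a b N))"
  then show "\<gamma> \<in> range period_class"
    using rcoset_period_class
    by (auto simp: period_group_def carrier_FactGroup carrier_period_lattice)
next
  fix \<gamma> assume "\<gamma> \<in> range period_class"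
  then obtain k where k: "\<gamma> = period_class k" by blast
  obtain t :: "complex^2" where "t $ 1 = 2 * pi * \<i> * of_int k"
    using ex_vec_nth_1_eq by blast
  then show "\<gamma> \<in> carrier (period_group (weights_family a b N))"
    using k rcoset_period_class[of t k a b N]
    by (auto simp: period_group_def carrier_FactGroup carrier_period_lattice intro!: image_eqI)
qed

lemma period_class_mult:
  "period_class k \<otimes>\<^bsub>period_group (weights_family a b N)\<^esub> period_class l = period_class (k + l)"
proof (intro equalityI subsetI)
  fix s assume s: "s \<in> period_class (k + l)"
  \<comment> \<open>The product in the factor group is elementwise, so \<open>s\<close> has to be
    split as \<open>t + (s - t)\<close> with one summand in each class.\<close>
  obtain t where t: "t \<in> period_class k"
    using ex_vec_nth_1_eq unfolding period_class_def by blast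
  then have "s - t \<in> period_class l"
    using s by (simp add: period_class_def algebra_simps)
  then show "s \<in> period_class k \<otimes>\<^bsub>period_group (weights_family a b N)\<^esub> period_class l"
    using t unfolding period_group_def FactGroup_def set_mult_def period_lattice_def
    by (auto intro!: bexI[where A = "period_class k" and x = t] bexI[where A = "period_class l" and x = "s - t"])
qed (auto simp: period_group_def FactGroup_def set_mult_def period_lattice_def period_class_def
    algebra_simps)

lemma period_group_one: "\<one>\<^bsub>period_group (weights_family a b N)\<^esub> = period_class 0"
  by (simp add: period_group_def FactGroup_def isotropy_weights_family period_class_def)

text \<open>Through \<open>period_class\<close> the group axioms become those of addition of
  integers.\<close>

lemma group_period_group: "group (period_group (weights_family a b N))"
proof (rule groupI)
  fix x assume "x \<in> carrier (period_group (weights_family a b N))"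
  then obtain k where "x = period_class k"
    by (auto simp: carrier_period_group)
  then show "\<exists>y\<in>carrier (period_group (weights_family a b N)).
      y \<otimes>\<^bsub>period_group (weights_family a b N)\<^esub> x = \<one>\<^bsub>period_group (weights_family a b N)\<^esub>"
    by (intro bexI[of _ "period_class (- k)"])
      (auto simp: period_class_mult carrier_period_group period_group_one)
qed (auto simp: carrier_period_group period_class_mult period_group_one add_ac)

lemma positive_generator_eq: "positive_generator (weights_family a b N) = period_class 1"
  by (simp add: positive_generator_def period_class_def pairing_2 weights_family_nth)

lemma inv_period_class:
  "inv\<^bsub>period_group (weights_family a b N)\<^esub> period_class k = period_class (- k)"
  by (rule group.inv_equality[OF group_period_group])
    (auto simp: period_class_mult carrier_period_group period_group_one)

text \<open>Integer induction in both directions from 0, multiplying by the generator upwards and by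
  its inverse downwards.\<close>

lemma generate_period_group:
  "generate (period_group (weights_family a b N)) {period_class 1}
     = carrier (period_group (weights_family a b N))"
proof -
  have "period_class k \<in> generate (period_group (weights_family a b N)) {period_class 1}" (is "_ \<in> ?H") for k
  proof (induction k rule: int_induct[where k = 0])
    case base
    show ?case
      using generate.one by (metis period_group_one)
  next
    case (step1 k)
    have "period_class k \<otimes>\<^bsub>period_group (weights_family a b N)\<^esub> period_class 1 \<in> ?H"
      by (intro generate.eng step1.IH generate.incl) simp
    then show ?case
      by (simp add: period_class_mult)
  next
    case (step2 k)
    have "inv\<^bsub>period_group (weights_family a b N)\<^esub> period_class 1 \<in> ?H"
      by (rule generate.inv) simp
    then have "period_class k \<otimes>\<^bsub>period_group (weights_family a b N)\<^esub> period_class (- 1) \<in> ?H"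
      unfolding inv_period_class by (rule generate.eng[OF step2.IH])
    then show ?case
      by (simp add: period_class_mult)
  qed
  moreover have "generate (period_group (weights_family a b N)) {period_class 1}
      \<subseteq> carrier (period_group (weights_family a b N))"
    by (rule group.generate_incl[OF group_period_group]) (auto simp: carrier_period_group)
  ultimately show ?thesis
    by (auto simp: carrier_period_group)
qed

section \<open>Envelope monodromy and its action\<close>

text \<open>On a resonance \<open>nu\<close> is constant along cosets, so a single representative
  gives the value, and only its first coordinate enters.\<close>

lemma nu_coset_period_class:
  "nu_coset (weights_family a b N) (diag_exponent n) (period_class k)
     = of_nat n * (a + b + of_nat N) * (2 * pi * \<i> * of_int k)"
proof -
  obtain t :: "complex^2" where t: "t $ 1 = 2 * pi * \<i> * of_int k"
    using ex_vec_nth_1_eq by blast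
  have "nu_coset (weights_family a b N) (diag_exponent n) (period_class k)
          = pairing (nu (weights_family a b N) (diag_exponent n)) t"
    unfolding rcoset_period_class[OF t, of a b N, symmetric]
    by (rule nu_coset_rcoset) (simp add: resonance_monoid_weights_family)
  then show ?thesis
    by (simp add: nu_diag_exponent pairing_2 t)
qed

text \<open>The \<open>N\<close>-dependent summand is \<open>2 * pi * \<i>\<close> times the integer
  \<open>n * N * k\<close>, which the exponential kills. This is where the monodromy forgets
  \<open>N\<close>.\<close>

lemma exp_nu_coset_period_class:
  "exp (nu_coset (weights_family a b N) (diag_exponent n) (period_class k))
     = exp (2 * pi * \<i> * of_int (int n * k) * (a + b))"
proof -
  have "nu_coset (weights_family a b N) (diag_exponent n) (period_class k)
      = 2 * pi * \<i> * of_int (int n * k) * (a + b) + 2 * of_int (int n * int N * k) * pi * \<i>"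
    by (simp add: nu_coset_period_class algebra_simps)
  then show ?thesis
    by (simp only: exp_add exp_integer_2pi[OF Ints_of_int] mult_1_right)
qed

lemma env_monodromy_indep: "env_monodromy (weights_family a b N) = env_monodromy (weights_family a b M)"
proof -
  have "Poly_Mapping.mapp (\<lambda>\<alpha> c. exp (nu_coset (weights_family a b N) \<alpha> \<gamma>) * c) p
      = Poly_Mapping.mapp (\<lambda>\<alpha> c. exp (nu_coset (weights_family a b M) \<alpha> \<gamma>) * c) p"
    if "\<gamma> \<in> carrier (period_group (weights_family a b M))" "p \<in> env_ring (weights_family a b M)" for \<gamma> p
  proof (rule poly_mapping_eqI)
    fix \<alpha>
    \<comment> \<open>Only exponents in the support of \<open>p\<close> count, since
      \<open>mapp\<close> yields 0 elsewhere; those are resonances, where the exponential is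
      known.\<close>
    have "exp (nu_coset (weights_family a b N) \<alpha> \<gamma>) = exp (nu_coset (weights_family a b M) \<alpha> \<gamma>)"
      if "\<alpha> \<in> Poly_Mapping.keys p"
      using that \<open>\<gamma> \<in> _\<close> \<open>p \<in> _\<close>
      by (auto simp: carrier_period_group env_ring_weights_family exp_nu_coset_period_class dest!: subsetD)
    then show "Poly_Mapping.lookup (Poly_Mapping.mapp (\<lambda>\<alpha> c. exp (nu_coset (weights_family a b N) \<alpha> \<gamma>) * c) p) \<alpha>
        = Poly_Mapping.lookup (Poly_Mapping.mapp (\<lambda>\<alpha> c. exp (nu_coset (weights_family a b M) \<alpha> \<gamma>) * c) p) \<alpha>"
      by (auto simp: lookup_mapp when_def)
  qed
  then show ?thesis
    unfolding env_monodromy_def period_group_indep[of a b N M] env_ring_indep[of a b N M]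
    by (auto intro!: restrict_ext)
qed

lemma env_act_indep: "env_act (weights_family a b N) = env_act (weights_family a b M)"
  unfolding env_act_def period_group_indep[of a b N M] env_points_indep[of a b N M]
    env_ring_indep[of a b N M] env_monodromy_indep[of a b N M] by (rule refl)

lemma env_functions_indep: "env_functions (weights_family a b N) = env_functions (weights_family a b M)"
  unfolding env_functions_def env_points_indep[of a b N M] env_ring_indep[of a b N M] by (rule refl)

lemma env_monodromy_env_X:
  "env_monodromy (weights_family a b N) (period_class 1) env_X = const (exp (2 * pi * \<i> * (a + b))) * env_X"
proof -
  have "env_monodromy (weights_family a b N) (period_class 1) env_X
      = Poly_Mapping.mapp (\<lambda>\<alpha> c. exp (nu_coset (weights_family a b N) \<alpha> (period_class 1)) * c) env_X"
    by (simp add: env_monodromy_def env_X_in_env_ring carrier_period_group)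
  also have "\<dots> = Poly_Mapping.single (diag_exponent 1) (exp (2 * pi * \<i> * (a + b)))"
    by (rule poly_mapping_eqI)
      (auto simp: env_X_eq_single lookup_mapp lookup_single when_def exp_nu_coset_period_class)
  finally show ?thesis
    by (simp add: env_X_eq_single const_mult_single)
qed

lemma env_coord_env_act:
  assumes q: "q \<in> env_points (weights_family a b N)"
  shows "env_coord (env_act (weights_family a b N) (period_class 1) q)
           = exp (2 * pi * \<i> * (a + b)) * env_coord q"
proof -
  have "env_coord (env_act (weights_family a b N) (period_class 1) q)
      = q (const (exp (2 * pi * \<i> * (a + b))) * env_X)"
    using q by (simp add: env_coord_def env_act_def env_monodromy_env_X env_X_in_env_ring
        carrier_period_group)
  then show ?thesis
    by (simp add: env_coord_def env_point_hom[OF q] env_ring_const env_X_in_env_ring)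
qed

section \<open>The operator \<open>delta0\<close>, the Camacho-Sad index and the connection\<close>

text \<open>As \<open>\<Lambda>\<^sub>0\<close> has first coefficient 1, comparing first coordinates
  determines the factor uniquely, which justifies the definite description.\<close>

lemma c0_diag_exponent: "c0 (weights_family a b N) (diag_exponent n) = of_nat n * (a + b + of_nat N)"
  unfolding c0_def by (rule the_equality) (auto simp: nu_diag_exponent vec_2_eq_iff weights_family_nth)

lemma delta0_single_diag_exponent:
  "delta0 (weights_family a b N) (Poly_Mapping.single (diag_exponent n) c)
     = Poly_Mapping.single (diag_exponent n) (of_nat n * (a + b + of_nat N) * c)"
  by (rule poly_mapping_eqI)
    (auto simp: delta0_def lookup_mapp lookup_single when_def c0_diag_exponent)

text \<open>Exhibiting \<open>p\<close> with the right coefficients shows that the function under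
  \<open>Abs_poly_mapping\<close> has finite support.\<close>

lemma coeff_deriv_eqI:
  assumes "\<And>\<alpha>. deriv (\<lambda>u. Poly_Mapping.lookup (s u) \<alpha>) z = Poly_Mapping.lookup p \<alpha>"
  shows "coeff_deriv s z = p"
  unfolding coeff_deriv_def assms by (rule lookup_inverse)

lemma coeff_deriv_constant: "coeff_deriv (\<lambda>_. p) z = 0"
  by (rule coeff_deriv_eqI) simp

text \<open>Here \<open>const\<close> is the coordinate function \<open>t\<close>, viewed as a
  section, so its derivative is the unit.\<close>

lemma coeff_deriv_const: "coeff_deriv const z = 1"
  by (rule coeff_deriv_eqI) (auto simp: const_def lookup_single lookup_one when_def)

lemma env_point_in_env_points: "env_point (weights_family a b N) x \<in> env_points (weights_family a b N)"
  unfolding env_point_def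
  by (rule the_inv_into_into[OF inj_on_env_coord])
    (simp_all add: bij_betw_imp_surj_on[OF bij_betw_env_coord])

lemma env_coord_env_point: "env_coord (env_point (weights_family a b N) x) = x"
  unfolding env_point_def
  by (rule f_the_inv_into_f_bij_betw[OF bij_betw_env_coord]) simp

lemma fol_A_weights_family: "fol_A (weights_family a b N) t x = t"
proof -
  \<comment> \<open>\<open>const t\<close> is the monomial of exponent
    \<open>diag_exponent 0\<close>, on which the eigenvalue of \<open>delta0\<close> is 0.\<close>
  have "delta0 (weights_family a b N) (const t) = 0"
    using delta0_single_diag_exponent[of a b N 0 t] by (simp add: const_def)
  then show ?thesis
    by (simp add: fol_A_def fol_field_def coeff_deriv_const env_point_hom[OF env_point_in_env_points])
qed

lemma fol_B_weights_family: "fol_B (weights_family a b N) t x = (a + b + of_nat N) * x"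
proof -
  have "fol_field (weights_family a b N) (\<lambda>_. env_X) t = const (a + b + of_nat N) * env_X"
    unfolding fol_field_def coeff_deriv_constant
    unfolding env_X_eq_single delta0_single_diag_exponent
    by (simp add: const_mult_single)
  then show ?thesis
    using env_coord_env_point[of a b N x]
    by (simp add: fol_B_def env_coord_def env_point_hom[OF env_point_in_env_points]
        env_ring_const env_X_in_env_ring)
qed

text \<open>The quotient \<open>B / A\<close> is linear in \<open>x\<close> with slope
  \<open>(a + b + N) / t\<close>, a simple pole whose residue is the numerator.\<close>

lemma env_cs_index_weights_family: "env_cs_index (weights_family a b N) = a + b + of_nat N"
proof -
  \<comment> \<open>This includes \<open>t = 0\<close>, where both sides are 0 by the convention for
    division by zero.\<close>
  have "deriv (\<lambda>x. (a + b + of_nat N) * x / t) 0 = (a + b + of_nat N) / t" for t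
  proof (rule DERIV_imp_deriv)
    show "((\<lambda>x. (a + b + of_nat N) * x / t) has_field_derivative (a + b + of_nat N) / t) (at 0)"
      using DERIV_cdivide[OF DERIV_cmult[OF DERIV_ident]] by fastforce
  qed
  then show ?thesis
    using residue_simple[of UNIV 0 "\<lambda>_. a + b + of_nat N"]
    by (simp add: env_cs_index_def camacho_sad_index_def fol_A_weights_family fol_B_weights_family)
qed

text \<open>The connections are told apart by the constant section \<open>X\<close>.\<close>

lemma log_connection_inj:
  assumes "log_connection (weights_family a b N) = log_connection (weights_family a b M)"
  shows "N = M"
proof -
  let ?s = "\<lambda>z\<in>- {0}. env_X"
  \<comment> \<open>The connection is a restricted function, so it can be evaluated at
    \<open>?s\<close> only once \<open>?s\<close> is known to be a section.\<close>
  have s: "?s \<in> env_sections (weights_family a b K) (- {0})" for K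
  proof -
    have "finite (\<Union>z\<in>- {0 :: complex}. Poly_Mapping.keys (?s z))"
      by (rule finite_subset[of _ "Poly_Mapping.keys env_X"]) auto
    moreover have "(\<lambda>z. Poly_Mapping.lookup (?s z) \<alpha>) holomorphic_on (- {0})" for \<alpha>
      by (rule holomorphic_transform[of "\<lambda>_. Poly_Mapping.lookup env_X \<alpha>"]) auto
    ultimately show ?thesis
      by (auto simp: env_sections_def env_X_in_env_ring)
  qed
  \<comment> \<open>At the point 1 the factor \<open>1 / z\<close> is 1; the derivative terms then
    cancel and the eigenvalues of \<open>delta0\<close> on \<open>X\<close> remain.\<close>
  have "coeff_deriv ?s 1 - delta0 (weights_family a b N) env_X
      = coeff_deriv ?s 1 - delta0 (weights_family a b M) env_X"
    using fun_cong[OF fun_cong[OF assms, of ?s], of 1] s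
    by (simp add: log_connection_def const_def)
  then have "delta0 (weights_family a b N) env_X = delta0 (weights_family a b M) env_X"
    by simp
  then have "Poly_Mapping.lookup (delta0 (weights_family a b N) env_X) (diag_exponent 1)
      = Poly_Mapping.lookup (delta0 (weights_family a b M) env_X) (diag_exponent 1)"
    by simp
  then show ?thesis
    unfolding env_X_eq_single delta0_single_diag_exponent by simp
qed

theorem proposition6p15:
  fixes a b :: complex
  assumes "Re a > 0" and "Re b > 0"
  shows
    "(\<forall>N. uniform_maximal_rank (weights_family a b N) \<and> poincare_domain (weights_family a b N)) \<and>
     (\<forall>N. isotropy (weights_family a b N) = {t. t $ 1 = 0} \<and>
          residual_weight (weights_family a b N) 1 = (\<lambda>t\<in>{t. t $ 1 = 0}. 1 * t $ 2) \<and>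
          residual_weight (weights_family a b N) 2 = (\<lambda>t\<in>{t. t $ 1 = 0}. - 1 * t $ 2)) \<and>
     (\<forall>N. bij_betw (\<lambda>p::complex poly. poly (map_poly const p) env_X)
            UNIV (env_ring (weights_family a b N)) \<and>
          bij_betw env_coord (env_points (weights_family a b N)) UNIV \<and>
          {q \<in> env_points (weights_family a b N). env_coord q = 0} = {env_origin (weights_family a b N)}) \<and>
     (\<forall>N M. envelope (weights_family a b N) = envelope (weights_family a b M)) \<and>
     (\<forall>N M. period_group (weights_family a b N) = period_group (weights_family a b M) \<and>
            env_monodromy (weights_family a b N) = env_monodromy (weights_family a b M)) \<and>
     (\<forall>N. positive_generator (weights_family a b N) \<in> carrier (period_group (weights_family a b N)) \<and>
          generate (period_group (weights_family a b N)) {positive_generator (weights_family a b N)}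
            = carrier (period_group (weights_family a b N)) \<and>
          env_monodromy (weights_family a b N) (positive_generator (weights_family a b N)) env_X
            = const (exp (2 * pi * \<i> * (a + b))) * env_X \<and>
          (\<forall>q\<in>env_points (weights_family a b N).
             env_coord (env_act (weights_family a b N) (positive_generator (weights_family a b N)) q)
               = exp (2 * pi * \<i> * (a + b)) * env_coord q)) \<and>
     (\<forall>N. invariant_axis (fol_A (weights_family a b N)) (fol_B (weights_family a b N)) \<and>
          env_cs_index (weights_family a b N) = a + b + of_nat N) \<and>
     (\<forall>N M. env_groupoid (weights_family a b N) = env_groupoid (weights_family a b M)) \<and>
     (\<forall>N M. (env_stack (weights_family a b N) :: ('t, 'p, (complex^2) set, mpoly3 \<Rightarrow> complex) stack)
              = env_stack (weights_family a b M)) \<and>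
     (\<forall>N M. N \<noteq> M \<longrightarrow>
        log_connection (weights_family a b N) \<noteq> log_connection (weights_family a b M) \<and>
        env_cs_index (weights_family a b N) \<noteq> env_cs_index (weights_family a b M))"
proof (intro conjI allI impI ballI)
  fix N M :: nat
  show "uniform_maximal_rank (weights_family a b N)" "poincare_domain (weights_family a b N)"
    using assms by (rule uniform_maximal_rank_weights_family poincare_domain_weights_family)+
  show "isotropy (weights_family a b N) = {t. t $ 1 = 0}"
    "residual_weight (weights_family a b N) 1 = (\<lambda>t\<in>{t. t $ 1 = 0}. 1 * t $ 2)"
    "residual_weight (weights_family a b N) 2 = (\<lambda>t\<in>{t. t $ 1 = 0}. - 1 * t $ 2)"
    by (rule isotropy_weights_family residual_weight_weights_family)+
  show "bij_betw (\<lambda>p::complex poly. poly (map_poly const p) env_X) UNIV (env_ring (weights_family a b N))"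
    "bij_betw env_coord (env_points (weights_family a b N)) UNIV"
    "{q \<in> env_points (weights_family a b N). env_coord q = 0} = {env_origin (weights_family a b N)}"
    by (rule bij_betw_poly_env_ring bij_betw_env_coord env_coord_eq_0_iff)+
  show "envelope (weights_family a b N) = envelope (weights_family a b M)"
    "period_group (weights_family a b N) = period_group (weights_family a b M)"
    "env_monodromy (weights_family a b N) = env_monodromy (weights_family a b M)"
    by (rule envelope_indep period_group_indep env_monodromy_indep)+
  show "positive_generator (weights_family a b N) \<in> carrier (period_group (weights_family a b N))"
    by (simp add: positive_generator_eq carrier_period_group)
  show "generate (period_group (weights_family a b N)) {positive_generator (weights_family a b N)}
      = carrier (period_group (weights_family a b N))"
    by (simp add: positive_generator_eq generate_period_group)
  show "env_monodromy (weights_family a b N) (positive_generator (weights_family a b N)) env_X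
      = const (exp (2 * pi * \<i> * (a + b))) * env_X"
    by (simp add: positive_generator_eq env_monodromy_env_X)
  show "env_coord (env_act (weights_family a b N) (positive_generator (weights_family a b N)) q)
      = exp (2 * pi * \<i> * (a + b)) * env_coord q" if "q \<in> env_points (weights_family a b N)" for q
    using that by (simp add: positive_generator_eq env_coord_env_act)
  show "invariant_axis (fol_A (weights_family a b N)) (fol_B (weights_family a b N))"
    by (simp add: invariant_axis_def fol_B_weights_family)
  show "env_cs_index (weights_family a b N) = a + b + of_nat N"
    by (rule env_cs_index_weights_family)
  \<comment> \<open>Groupoid and stack are built from the group, the points, the regular functions
    and the action alone, and each of these four agrees for all members.\<close>
  show "env_groupoid (weights_family a b N) = env_groupoid (weights_family a b M)"
    unfolding env_groupoid_def period_group_indep[of a b N M] env_points_indep[of a b N M]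
      env_functions_indep[of a b N M] env_act_indep[of a b N M] by (rule refl)
  show "(env_stack (weights_family a b N) :: ('t, 'p, (complex^2) set, mpoly3 \<Rightarrow> complex) stack)
      = env_stack (weights_family a b M)"
    unfolding env_stack_def period_group_indep[of a b N M] env_points_indep[of a b N M]
      env_functions_indep[of a b N M] env_act_indep[of a b N M] by (rule refl)
  assume "N \<noteq> M"
  then show "log_connection (weights_family a b N) \<noteq> log_connection (weights_family a b M)"
    "env_cs_index (weights_family a b N) \<noteq> env_cs_index (weights_family a b M)"
    using log_connection_inj by (auto simp: env_cs_index_weights_family)
qed

end
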